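(* Let $E$ be an infinite, locally finite, connected bi-directed graph. The functor $\mathcal{F}$ from the category $\mathcal{E}$ of black-and-white subgraphs of $E$ to the category of abelian groups is continuous, i.e. it commutes with direct limits: whenever an object $G$ is the direct limit in $\mathcal{E}$ of a direct system $(G_i)$, the canonical homomorphism $\varinjlim \mathcal{F}(G_i)\to\mathcal{F}(G)$ is an isomorphism.
   Context: Graphs. A bi-directed graph $E=(E^0,E^1,s,r)$ is obtained from a non-directed graph (loops and multiple edges allowed) by replacing each non-oriented edge with two distinct edges $e,\overline e\in E^1$ of opposite orientations (source $s(\overline e)=r(e)$, range $r(\overline e)=s(e)$, $\overline{\overline e}=e$). Locally finite means that every vertex is incident to only finitely many edges; connectedness is that of the underlying non-directed graph. Category $\mathcal{E}$ of black-and-white subgraphs of $E$. An object is determined by a set $\Omega\subseteq E^0$ of vertices: it contains as black edges all edges of $E$ with both source and range in $\Omega$, and as white edges all edges of $E$ with exactly one of source, range in $\Omega$. (For $\Omega=E^0$ one gets $E$ itself with all edges black.) An elementary homomorphism $f:G\to F$ exists (and is the inclusion) if $F$ contains all vertices of $G$, all black and white edges of $G$ are black edges of $F$, and every white edge of $F$ has an endpoint which is an endpoint of an edge of $G$; identity maps are also elementary homomorphisms. Morphisms of $\mathcal{E}$ are compositions of elementary homomorphisms. Functor $\mathcal{F}$. To an object $G$ of $\mathcal{E}$ one associates the abelian group $\mathcal{F}(G)$ with generators all (black and white) edges of $G$ and one relation $x=\sum_{y}\lambda_{x,y}\,y$ for every black edge $x$ of $G$, where $y$ runs over all black and white edges of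 $G$ and $\lambda_{x,y}=1$ if $r(x)=s(y)$ and $y\neq\overline x$, and $\lambda_{x,y}=0$ otherwise. To a morphism $G\to F$ one associates the homomorphism $\mathcal{F}(G)\to\mathcal{F}(F)$ sending each generator to itself. *)

theory Defs
  imports "HOL-Algebra.Free_Abelian_Groups" "Graph_Theory.Bidirected_Digraph"
    "Graph_Theory.Digraph_Component"
begin

section \<open>Direct systems and direct limits in a category\<close>

record ('o, 'm) category =
  Obj :: "'o set"
  Hom :: "'o \<Rightarrow> 'o \<Rightarrow> 'm set"
  Id :: "'o \<Rightarrow> 'm"
  Comp :: "'m \<Rightarrow> 'm \<Rightarrow> 'm"   \<comment> \<open>\<open>Comp C g f\<close> is \<open>g\<close> after \<open>f\<close>\<close>

definition directed_set :: "'i set \<Rightarrow> ('i \<Rightarrow> 'i \<Rightarrow> bool) \<Rightarrow> bool" where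
  "directed_set I leq \<longleftrightarrow>
     I \<noteq> {} \<and>
     (\<forall>i\<in>I. leq i i) \<and>
     (\<forall>i\<in>I. \<forall>j\<in>I. \<forall>k\<in>I. leq i j \<longrightarrow> leq j k \<longrightarrow> leq i k) \<and>
     (\<forall>i\<in>I. \<forall>j\<in>I. \<exists>k\<in>I. leq i k \<and> leq j k)"

definition direct_system ::
  "('o, 'm) category \<Rightarrow> 'i set \<Rightarrow> ('i \<Rightarrow> 'i \<Rightarrow> bool) \<Rightarrow> ('i \<Rightarrow> 'o) \<Rightarrow> ('i \<Rightarrow> 'i \<Rightarrow> 'm) \<Rightarrow> bool" where
  "direct_system C I leq X \<phi> \<longleftrightarrow>
     directed_set I leq \<and>
     (\<forall>i\<in>I. X i \<in> Obj C) \<and>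
     (\<forall>i\<in>I. \<forall>j\<in>I. leq i j \<longrightarrow> \<phi> i j \<in> Hom C (X i) (X j)) \<and>
     (\<forall>i\<in>I. \<phi> i i = Id C (X i)) \<and>
     (\<forall>i\<in>I. \<forall>j\<in>I. \<forall>k\<in>I. leq i j \<longrightarrow> leq j k \<longrightarrow> Comp C (\<phi> j k) (\<phi> i j) = \<phi> i k)"

definition cocone ::
  "('o, 'm) category \<Rightarrow> 'i set \<Rightarrow> ('i \<Rightarrow> 'i \<Rightarrow> bool) \<Rightarrow> ('i \<Rightarrow> 'o) \<Rightarrow> ('i \<Rightarrow> 'i \<Rightarrow> 'm)
     \<Rightarrow> 'o \<Rightarrow> ('i \<Rightarrow> 'm) \<Rightarrow> bool" where
  "cocone C I leq X \<phi> G \<psi> \<longleftrightarrow>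
     G \<in> Obj C \<and>
     (\<forall>i\<in>I. \<psi> i \<in> Hom C (X i) G) \<and>
     (\<forall>i\<in>I. \<forall>j\<in>I. leq i j \<longrightarrow> Comp C (\<psi> j) (\<phi> i j) = \<psi> i)"

definition is_direct_limit ::
  "('o, 'm) category \<Rightarrow> 'i set \<Rightarrow> ('i \<Rightarrow> 'i \<Rightarrow> bool) \<Rightarrow> ('i \<Rightarrow> 'o) \<Rightarrow> ('i \<Rightarrow> 'i \<Rightarrow> 'm)
     \<Rightarrow> 'o \<Rightarrow> ('i \<Rightarrow> 'm) \<Rightarrow> bool" where
  "is_direct_limit C I leq X \<phi> G \<psi> \<longleftrightarrow>
     cocone C I leq X \<phi> G \<psi> \<and>
     (\<forall>H \<theta>. cocone C I leq X \<phi> H \<theta> \<longrightarrow>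
        (\<exists>!u. u \<in> Hom C G H \<and> (\<forall>i\<in>I. Comp C u (\<psi> i) = \<theta> i)))"


section \<open>Direct limits of abelian groups\<close>

text \<open>
  The direct limit of abelian groups is the direct sum modulo the subgroup generated by
  all \<open>\<iota>\<^sub>i(a) - \<iota>\<^sub>j(f\<^sub>i\<^sub>j(a))\<close> with \<open>i \<le> j\<close>.  Groups are written multiplicatively
  in HOL-Algebra.
\<close>

definition sum_inj :: "'i set \<Rightarrow> ('i \<Rightarrow> ('a, 'b) monoid_scheme) \<Rightarrow> 'i \<Rightarrow> 'a \<Rightarrow> 'i \<Rightarrow> 'a" where
  "sum_inj I A i a = (\<lambda>k\<in>I. if k = i then a else \<one>\<^bsub>A k\<^esub>)"

definition limit_relations ::
  "'i set \<Rightarrow> ('i \<Rightarrow> 'i \<Rightarrow> bool) \<Rightarrow> ('i \<Rightarrow> ('a, 'b) monoid_scheme) \<Rightarrow> ('i \<Rightarrow> 'i \<Rightarrow> 'a \<Rightarrow> 'a)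
     \<Rightarrow> ('i \<Rightarrow> 'a) set" where
  "limit_relations I leq A f =
     generate (sum_group I A)
       {sum_inj I A i a \<otimes>\<^bsub>sum_group I A\<^esub> inv\<^bsub>sum_group I A\<^esub> (sum_inj I A j (f i j a)) | i j a.
          i \<in> I \<and> j \<in> I \<and> leq i j \<and> a \<in> carrier (A i)}"

definition limit_group ::
  "'i set \<Rightarrow> ('i \<Rightarrow> 'i \<Rightarrow> bool) \<Rightarrow> ('i \<Rightarrow> ('a, 'b) monoid_scheme) \<Rightarrow> ('i \<Rightarrow> 'i \<Rightarrow> 'a \<Rightarrow> 'a)
     \<Rightarrow> ('i \<Rightarrow> 'a) set monoid" where
  "limit_group I leq A f = sum_group I A Mod limit_relations I leq A f"

definition limit_inj ::
  "'i set \<Rightarrow> ('i \<Rightarrow> 'i \<Rightarrow> bool) \<Rightarrow> ('i \<Rightarrow> ('a, 'b) monoid_scheme) \<Rightarrow> ('i \<Rightarrow> 'i \<Rightarrow> 'a \<Rightarrow> 'a)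
     \<Rightarrow> 'i \<Rightarrow> 'a \<Rightarrow> ('i \<Rightarrow> 'a) set" where
  "limit_inj I leq A f i a = limit_relations I leq A f #>\<^bsub>sum_group I A\<^esub> sum_inj I A i a"

text \<open>
  The homomorphism from the direct limit to \<open>B\<close> induced by a compatible family
  \<open>g i\<close> from \<open>A i\<close> to \<open>B\<close>.  Extensionality (the value \<open>undefined\<close> off the carrier) makes it
  unique as a HOL function.
\<close>

definition canonical_hom ::
  "'i set \<Rightarrow> ('i \<Rightarrow> 'i \<Rightarrow> bool) \<Rightarrow> ('i \<Rightarrow> ('a, 'b) monoid_scheme) \<Rightarrow> ('i \<Rightarrow> 'i \<Rightarrow> 'a \<Rightarrow> 'a)
     \<Rightarrow> ('c, 'd) monoid_scheme \<Rightarrow> ('i \<Rightarrow> 'a \<Rightarrow> 'c) \<Rightarrow> ('i \<Rightarrow> 'a) set \<Rightarrow> 'c" where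
  "canonical_hom I leq A f B g =
     (THE h. h \<in> hom (limit_group I leq A f) B \<and>
             h \<in> extensional (carrier (limit_group I leq A f)) \<and>
             (\<forall>i\<in>I. \<forall>a\<in>carrier (A i). h (limit_inj I leq A f i a) = g i a))"


section \<open>Black-and-white subgraphs\<close>

definition locally_finite :: "('v, 'e) pre_digraph \<Rightarrow> bool" where
  "locally_finite E \<longleftrightarrow> (\<forall>v\<in>verts E. finite (in_arcs E v \<union> out_arcs E v))"

text \<open>An object is represented by the set \<open>\<Omega>\<close> of vertices that determines it.\<close>

definition black :: "('v, 'e) pre_digraph \<Rightarrow> 'v set \<Rightarrow> 'e set" where
  "black E \<Omega> = {e \<in> arcs E. tail E e \<in> \<Omega> \<and> head E e \<in> \<Omega>}"

definition white :: "('v, 'e) pre_digraph \<Rightarrow> 'v set \<Rightarrow> 'e set" where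
  "white E \<Omega> = {e \<in> arcs E. (tail E e \<in> \<Omega>) \<noteq> (head E e \<in> \<Omega>)}"

definition bw_edges :: "('v, 'e) pre_digraph \<Rightarrow> 'v set \<Rightarrow> 'e set" where
  "bw_edges E \<Omega> = black E \<Omega> \<union> white E \<Omega>"

definition endpoints :: "('v, 'e) pre_digraph \<Rightarrow> 'e \<Rightarrow> 'v set" where
  "endpoints E e = {tail E e, head E e}"

definition elementary :: "('v, 'e) pre_digraph \<Rightarrow> 'v set \<Rightarrow> 'v set \<Rightarrow> bool" where
  "elementary E G F \<longleftrightarrow>
     G \<subseteq> verts E \<and> F \<subseteq> verts E \<and>
     (G = F \<or>
      (G \<subseteq> F \<and> bw_edges E G \<subseteq> black E F \<and>
       (\<forall>e\<in>white E F. \<exists>v\<in>endpoints E e. \<exists>g\<in>bw_edges E G. v \<in> endpoints E g)))"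

text \<open>
  Elementary homomorphisms, hence also their compositions, are inclusions.  The morphism from
  \<open>G\<close> to \<open>F\<close>, if there is one, is therefore recorded as the pair \<open>(G, F)\<close>; it exists if
  \<open>G\<close> and \<open>F\<close> are joined by a finite chain of elementary homomorphisms.
\<close>

definition bw_category :: "('v, 'e) pre_digraph \<Rightarrow> ('v set, 'v set \<times> 'v set) category" where
  "bw_category E =
     \<lparr> Obj = {\<Omega>. \<Omega> \<subseteq> verts E},
       Hom = (\<lambda>G F. {m. m = (G, F) \<and> (elementary E)\<^sup>+\<^sup>+ G F}),
       Id = (\<lambda>G. (G, G)),
       Comp = (\<lambda>n m. (fst m, snd n)) \<rparr>"


section \<open>The functor to abelian groups\<close>

text \<open>In the following, \<open>rv\<close> is the edge reversal of the bi-directed graph \<open>E\<close>.\<close>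

definition lam :: "('v, 'e) pre_digraph \<Rightarrow> ('e \<Rightarrow> 'e) \<Rightarrow> 'e \<Rightarrow> 'e \<Rightarrow> int" where
  "lam E rv x y = (if head E x = tail E y \<and> y \<noteq> rv x then 1 else 0)"

text \<open>
  \<open>G\<close> may have infinitely many edges, and \<open>sum\<close> over an infinite set is \<open>0\<close>; so the sum ranges
  over the edges with nonzero coefficient, which are finitely many if \<open>E\<close> is locally finite.
\<close>

definition edge_relation ::
  "('v, 'e) pre_digraph \<Rightarrow> ('e \<Rightarrow> 'e) \<Rightarrow> 'v set \<Rightarrow> 'e \<Rightarrow> 'e \<Rightarrow>\<^sub>0 int" where
  "edge_relation E rv G x =
     frag_of x - (\<Sum>y\<in>{y \<in> bw_edges E G. lam E rv x y \<noteq> 0}. frag_cmul (lam E rv x y) (frag_of y))"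

definition edge_relations ::
  "('v, 'e) pre_digraph \<Rightarrow> ('e \<Rightarrow> 'e) \<Rightarrow> 'v set \<Rightarrow> ('e \<Rightarrow>\<^sub>0 int) set" where
  "edge_relations E rv G =
     generate (free_Abelian_group (bw_edges E G)) (edge_relation E rv G ` black E G)"

definition F_obj ::
  "('v, 'e) pre_digraph \<Rightarrow> ('e \<Rightarrow> 'e) \<Rightarrow> 'v set \<Rightarrow> ('e \<Rightarrow>\<^sub>0 int) set monoid" where
  "F_obj E rv G = free_Abelian_group (bw_edges E G) Mod edge_relations E rv G"

definition F_gen ::
  "('v, 'e) pre_digraph \<Rightarrow> ('e \<Rightarrow> 'e) \<Rightarrow> 'v set \<Rightarrow> 'e \<Rightarrow> ('e \<Rightarrow>\<^sub>0 int) set" where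
  "F_gen E rv G e = edge_relations E rv G #>\<^bsub>free_Abelian_group (bw_edges E G)\<^esub> frag_of e"

definition F_mor ::
  "('v, 'e) pre_digraph \<Rightarrow> ('e \<Rightarrow> 'e) \<Rightarrow> 'v set \<times> 'v set
     \<Rightarrow> ('e \<Rightarrow>\<^sub>0 int) set \<Rightarrow> ('e \<Rightarrow>\<^sub>0 int) set" where
  "F_mor E rv m =
     (case m of (G, F) \<Rightarrow>
        (THE h. h \<in> hom (F_obj E rv G) (F_obj E rv F) \<and>
                h \<in> extensional (carrier (F_obj E rv G)) \<and>
                (\<forall>e\<in>bw_edges E G. h (F_gen E rv G e) = F_gen E rv F e)))"

end

theory Submission
  imports Defs
begin

text \<open>
  Every morphism of the category is an inclusion of vertex sets, so the theorem rests on two facts: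
  a direct limit \<open>G\<close> of a system \<open>X\<close> is the union of its members, and generators and relations of
  \<open>F_obj E rv G\<close> are the unions of those of the groups \<open>F_obj E rv (X i)\<close>.

  For the first fact (\<open>direct_limit_eq_union\<close>), the union must be shown to be a cocone, where the
  difficulty is that not every inclusion is a morphism.  If the system is eventually constant, the
  union is one of its members.  Otherwise each member has all its edges black in some later member;
  hence the union has no white edges, and the inclusions into it are elementary.  A morphism from
  the limit to the union then forces equality.

  For the second fact, an edge touches the union if and only if it touches a member.  The relation
  of a black edge \<open>x\<close> involves only edges starting at the head of \<open>x\<close>; all of these are edges of
  any subgraph in which \<open>x\<close> is black, so the relation is the same in all of them
  (\<open>edge_relation_mono\<close>).  As the system is directed, an element of \<open>F_obj E rv G\<close>, which involves
  finitely many edges, comes from some \<open>X i\<close>, and an element that vanishes in \<open>F_obj E rv G\<close>, which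
  is due to finitely many relations, vanishes at some stage (\<open>edge_relations_union\<close>).  These are
  the two hypotheses of the criterion \<open>canonical_hom_iso\<close> for a homomorphism from a direct limit
  of abelian groups to be an isomorphism.
\<close>

section \<open>Direct limits of abelian groups\<close>

lemma directed_set_nonempty:
  assumes "directed_set I leq"
  obtains i where "i \<in> I"
  using assms unfolding directed_set_def by blast

lemma directed_set_upper_bound:
  assumes "directed_set I leq" "i \<in> I" "j \<in> I"
  obtains k where "k \<in> I" "leq i k" "leq j k"
  using assms unfolding directed_set_def by metis

locale compatible_family =
  fixes I :: "'i set" and leq :: "'i \<Rightarrow> 'i \<Rightarrow> bool"
    and A :: "'i \<Rightarrow> ('a, 'b) monoid_scheme" and f :: "'i \<Rightarrow> 'i \<Rightarrow> 'a \<Rightarrow> 'a"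
    and B :: "('c, 'd) monoid_scheme" and g :: "'i \<Rightarrow> 'a \<Rightarrow> 'c"
  assumes directed: "directed_set I leq"
    and comm_group_A: "i \<in> I \<Longrightarrow> comm_group (A i)"
    and comm_group_B: "comm_group B"
    and f_hom: "i \<in> I \<Longrightarrow> j \<in> I \<Longrightarrow> leq i j \<Longrightarrow> f i j \<in> hom (A i) (A j)"
    and g_hom: "i \<in> I \<Longrightarrow> g i \<in> hom (A i) B"
    and compatible: "i \<in> I \<Longrightarrow> j \<in> I \<Longrightarrow> leq i j \<Longrightarrow> a \<in> carrier (A i) \<Longrightarrow> g j (f i j a) = g i a"
begin

abbreviation "L \<equiv> limit_group I leq A f"
abbreviation "R \<equiv> limit_relations I leq A f"
abbreviation "S \<equiv> sum_group I A"
abbreviation "stage \<equiv> limit_inj I leq A f"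

lemma group_A: "i \<in> I \<Longrightarrow> group (A i)"
  using comm_group_A by (simp add: comm_group_def)

lemma group_S: "group S"
  by (simp add: group_A)

lemma comm_group_S: "comm_group S"
proof (rule group.group_comm_groupI [OF group_S])
  fix x y assume "x \<in> carrier S" "y \<in> carrier S"
  then show "x \<otimes>\<^bsub>S\<^esub> y = y \<otimes>\<^bsub>S\<^esub> x"
    using comm_group_A
    by (auto simp: carrier_sum_group group_A PiE_iff comm_group_def comm_monoid.m_comm
        intro!: restrict_ext)
qed

lemma sum_inj_closed: "i \<in> I \<Longrightarrow> a \<in> carrier (A i) \<Longrightarrow> sum_inj I A i a \<in> carrier S"
  by (auto simp: carrier_sum_group group_A sum_inj_def group.is_monoid monoid.one_closed)

lemma sum_inj_hom: "i \<in> I \<Longrightarrow> sum_inj I A i \<in> hom (A i) S"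
proof (rule homI)
  assume i: "i \<in> I"
  show "sum_inj I A i x \<in> carrier S" if "x \<in> carrier (A i)" for x
    using i that by (rule sum_inj_closed)
  show "sum_inj I A i (x \<otimes>\<^bsub>A i\<^esub> y) = sum_inj I A i x \<otimes>\<^bsub>S\<^esub> sum_inj I A i y"
    if "x \<in> carrier (A i)" "y \<in> carrier (A i)" for x y
    by (auto simp: sum_inj_def fun_eq_iff group_A group.is_monoid monoid.l_one)
qed

lemma relators_closed:
  "{sum_inj I A i a \<otimes>\<^bsub>S\<^esub> inv\<^bsub>S\<^esub> (sum_inj I A j (f i j a)) | i j a.
      i \<in> I \<and> j \<in> I \<and> leq i j \<and> a \<in> carrier (A i)} \<subseteq> carrier S"
proof -
  interpret S: group S by (rule group_S)
  show ?thesis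
    using f_hom unfolding hom_def
    by (auto simp del: mult_sum_group inv_sum_group intro!: S.m_closed S.inv_closed sum_inj_closed)
qed

lemma subgroup_R: "subgroup R S"
  unfolding limit_relations_def
  by (rule group.generate_is_subgroup [OF group_S relators_closed])

lemma normal_R: "R \<lhd> S"
  by (simp add: comm_group.normal_iff_subgroup comm_group_S subgroup_R)

lemma group_L: "group L"
  unfolding limit_group_def by (rule normal.factorgroup_is_group [OF normal_R])

lemma stage_hom: "i \<in> I \<Longrightarrow> stage i \<in> hom (A i) L"
  using hom_compose [OF sum_inj_hom normal.r_coset_hom_Mod [OF normal_R]]
  by (simp add: limit_inj_def [abs_def] limit_group_def comp_def)

lemma stage_closed: "i \<in> I \<Longrightarrow> a \<in> carrier (A i) \<Longrightarrow> stage i a \<in> carrier L"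
  using stage_hom by (auto simp: hom_def)

lemma stage_transition:
  assumes "i \<in> I" "j \<in> I" "leq i j" "a \<in> carrier (A i)"
  shows "stage j (f i j a) = stage i a"
proof -
  interpret S: comm_group S by (rule comm_group_S)
  let ?x = "sum_inj I A i a" and ?y = "sum_inj I A j (f i j a)"
  have x: "?x \<in> carrier S" using assms by (simp add: sum_inj_closed)
  have y: "?y \<in> carrier S"
    using assms f_hom [of i j] by (intro sum_inj_closed) (auto simp: hom_def)
  have "?x \<otimes>\<^bsub>S\<^esub> inv\<^bsub>S\<^esub> ?y \<in> R"
    unfolding limit_relations_def by (rule generate.incl) (use assms in blast)
  then have "?x \<in> R #>\<^bsub>S\<^esub> ?y"
    using x y subgroup.subset [OF subgroup_R]
    by (metis S.inv_solve_right' S.m_closed S.inv_closed S.rcosI S.inv_solve_right)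
  then show ?thesis
    unfolding limit_inj_def by (metis S.repr_independence subgroup_R y)
qed

text \<open>Two elements can be moved to a common index before they are multiplied.\<close>

lemma stage_mult:
  assumes "i \<in> I" "a \<in> carrier (A i)" "j \<in> I" "b \<in> carrier (A j)"
  shows "\<exists>k\<in>I. \<exists>c\<in>carrier (A k). stage i a \<otimes>\<^bsub>L\<^esub> stage j b = stage k c"
proof -
  obtain k where k: "k \<in> I" "leq i k" "leq j k"
    using directed_set_upper_bound [OF directed] assms by metis
  have c: "f i k a \<in> carrier (A k)" "f j k b \<in> carrier (A k)"
    using f_hom k assms by (auto simp: hom_def)
  have "stage i a \<otimes>\<^bsub>L\<^esub> stage j b = stage k (f i k a) \<otimes>\<^bsub>L\<^esub> stage k (f j k b)"
    using k assms by (simp add: stage_transition)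
  also have "\<dots> = stage k (f i k a \<otimes>\<^bsub>A k\<^esub> f j k b)"
    using hom_mult [OF stage_hom c] k by simp
  finally show ?thesis
    using k c group_A by (meson group.is_monoid monoid.m_closed)
qed

text \<open>
  A representative in the direct sum is a finite product of elements of the groups \<open>A i\<close>, and
  \<open>stage_mult\<close> gathers the factors, by induction on the support, at one index.
\<close>

lemma every_element_at_a_stage:
  assumes "x \<in> carrier L"
  obtains i a where "i \<in> I" "a \<in> carrier (A i)" "x = stage i a"
proof -
  interpret S: comm_group S by (rule comm_group_S)
  have one: "\<exists>i\<in>I. \<exists>a\<in>carrier (A i). \<one>\<^bsub>L\<^esub> = stage i a"
  proof -
    obtain i where i: "i \<in> I" using directed_set_nonempty [OF directed] .
    have "stage i \<one>\<^bsub>A i\<^esub> = \<one>\<^bsub>L\<^esub>"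
      by (rule hom_one [OF stage_hom group_A group_L]) (use i in auto)
    then show ?thesis
      using i group_A by (metis group.is_monoid monoid.one_closed)
  qed
  \<comment> \<open>Bounding the support by \<open>T\<close>, instead of fixing it, allows for indices outside \<open>I\<close>
    and for components that are already trivial.\<close>
  have *: "s \<in> carrier S \<Longrightarrow> {i \<in> I. s i \<noteq> \<one>\<^bsub>A i\<^esub>} \<subseteq> T \<Longrightarrow>
     \<exists>i\<in>I. \<exists>a\<in>carrier (A i). R #>\<^bsub>S\<^esub> s = stage i a" if "finite T" for T s
    using that
  proof (induction T arbitrary: s rule: finite_induct)
    case empty
    have "s = \<one>\<^bsub>S\<^esub>"
      using empty by (auto simp: carrier_sum_group group_A PiE_iff extensional_def fun_eq_iff)
    then have "R #>\<^bsub>S\<^esub> s = \<one>\<^bsub>L\<^esub>"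
      using S.coset_join2 [OF S.one_closed subgroup_R subgroup.one_closed [OF subgroup_R]]
      by (simp add: limit_group_def)
    then show ?case using one by simp
  next
    case (insert t T)
    show ?case
    proof (cases "t \<in> I")
      case False
      then show ?thesis using insert by blast
    next
      case True
      define s' where "s' = s(t := \<one>\<^bsub>A t\<^esub>)"
      have st: "s t \<in> carrier (A t)"
        using insert.prems True by (auto simp: carrier_sum_group group_A)
      have fin: "finite {i \<in> I. s' i \<noteq> \<one>\<^bsub>A i\<^esub>}"
        by (rule finite_subset [of _ T]) (use insert in \<open>auto simp: s'_def\<close>)
      have s': "s' \<in> carrier S"
        using insert.prems True fin group_A [OF True]
        by (auto simp: carrier_sum_group group_A PiE_iff s'_def extensional_def
            group.is_monoid monoid.one_closed)
      have split: "s = sum_inj I A t (s t) \<otimes>\<^bsub>S\<^esub> s'"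
        using insert.prems True
        by (auto simp: carrier_sum_group group_A PiE_iff s'_def sum_inj_def extensional_def
            fun_eq_iff group.is_monoid monoid.l_one monoid.r_one)
      obtain j b where jb: "j \<in> I" "b \<in> carrier (A j)" "R #>\<^bsub>S\<^esub> s' = stage j b"
      proof -
        have "{i \<in> I. s' i \<noteq> \<one>\<^bsub>A i\<^esub>} \<subseteq> T"
          using insert.prems by (auto simp: s'_def)
        then show ?thesis using insert.IH [OF s'] that by blast
      qed
      have "R #>\<^bsub>S\<^esub> s = stage t (s t) \<otimes>\<^bsub>L\<^esub> stage j b"
        using hom_mult [OF normal.r_coset_hom_Mod [OF normal_R] sum_inj_closed [OF True st] s']
        by (simp add: split [symmetric] jb limit_inj_def limit_group_def del: mult_sum_group)
      then show ?thesis
        using stage_mult [OF True st jb(1,2)] by simp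
    qed
  qed
  obtain s where s: "s \<in> carrier S" "x = R #>\<^bsub>S\<^esub> s"
    using assms by (auto simp: limit_group_def carrier_FactGroup)
  then have "finite {i \<in> I. s i \<noteq> \<one>\<^bsub>A i\<^esub>}"
    by (simp add: carrier_sum_group group_A)
  from * [OF this s(1) subset_refl] show ?thesis
    using that s by blast
qed

text \<open>
  The maps \<open>g i\<close> combine to a homomorphism on the direct sum, and compatibility says that it
  kills the relations of the limit.
\<close>

lemma induced_hom_exists:
  "\<exists>h. h \<in> hom L B \<and> h \<in> extensional (carrier L) \<and>
       (\<forall>i\<in>I. \<forall>a\<in>carrier (A i). h (stage i a) = g i a)"
proof -
  interpret B: comm_group B by (rule comm_group_B)
  define H where "H = (\<lambda>x. gfinprod B (\<lambda>i. g i (x i)) I)"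
  have Hhom: "H \<in> hom S B"
    unfolding H_def by (rule B.hom_group_sum) (auto simp: g_hom group_A)
  then interpret H: group_hom S B H
    by (simp add: group_hom_def group_hom_axioms_def group_A)
  have H_inj: "H (sum_inj I A i a) = g i a" if ia: "i \<in> I" "a \<in> carrier (A i)" for i a
  proof -
    have g1: "g k \<one>\<^bsub>A k\<^esub> = \<one>\<^bsub>B\<^esub>" if "k \<in> I" for k
      using hom_one [OF g_hom group_A] that by simp
    have ga: "g i a \<in> carrier B" using g_hom ia by (auto simp: hom_def)
    have "H (sum_inj I A i a) = gfinprod B (\<lambda>k. g i a) {i}"
      unfolding H_def
      by (rule B.gfinprod_mono_neutral_cong_right)
        (use ia g1 ga in \<open>auto simp: sum_inj_def\<close>)
    also have "\<dots> = g i a"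
      using ga by (simp add: B.finprod_insert)
    finally show ?thesis .
  qed
  have "R \<subseteq> kernel S B H"
    unfolding limit_relations_def
  proof (rule group.generate_subgroup_incl [OF group_S _ H.subgroup_kernel], safe)
    fix i j a assume ij: "i \<in> I" "j \<in> I" "leq i j" and a: "a \<in> carrier (A i)"
    let ?x = "sum_inj I A i a" and ?y = "sum_inj I A j (f i j a)"
    have fa: "f i j a \<in> carrier (A j)" using f_hom [OF ij] a by (auto simp: hom_def)
    have x: "?x \<in> carrier S" and y: "?y \<in> carrier S"
      using ij a fa by (auto intro: sum_inj_closed)
    have "H (?x \<otimes>\<^bsub>S\<^esub> inv\<^bsub>S\<^esub> ?y) = g i a \<otimes>\<^bsub>B\<^esub> inv\<^bsub>B\<^esub> g j (f i j a)"
      using x y ij a fa by (simp add: H_inj del: mult_sum_group inv_sum_group)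
    also have "\<dots> = \<one>\<^bsub>B\<^esub>"
      using compatible [OF ij a] hom_in_carrier [OF g_hom [OF ij(1)] a] B.r_inv by simp
    finally show "?x \<otimes>\<^bsub>S\<^esub> inv\<^bsub>S\<^esub> ?y \<in> kernel S B H"
      using x y by (simp add: kernel_def del: mult_sum_group inv_sum_group)
  qed
  then obtain h where h: "h \<in> hom (S Mod R) B" "\<And>x. x \<in> carrier S \<Longrightarrow> h (R #>\<^bsub>S\<^esub> x) = H x"
    using H.FactGroup_universal_kernel [OF normal_R] by metis
  show ?thesis
  proof (intro exI conjI ballI)
    show "restrict h (carrier L) \<in> hom L B"
      using h(1) [folded limit_group_def] group.is_monoid [OF group_L]
      by (simp add: hom_def Pi_iff monoid.m_closed)
    show "restrict h (carrier L) (stage i a) = g i a" if "i \<in> I" "a \<in> carrier (A i)" for i a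
      using that stage_closed h(2) by (simp add: limit_inj_def sum_inj_closed H_inj)
  qed simp
qed

text \<open>
  Uniqueness of the induced homomorphism is clear from \<open>every_element_at_a_stage\<close>, so
  \<open>canonical_hom\<close> is well defined.
\<close>

lemma canonical_hom_spec:
  shows "canonical_hom I leq A f B g \<in> hom L B" (is ?hom)
    and "i \<in> I \<Longrightarrow> a \<in> carrier (A i) \<Longrightarrow> canonical_hom I leq A f B g (stage i a) = g i a"
proof -
  let ?P = "\<lambda>h. h \<in> hom L B \<and> h \<in> extensional (carrier L) \<and>
              (\<forall>i\<in>I. \<forall>a\<in>carrier (A i). h (stage i a) = g i a)"
  have "\<exists>!h. ?P h"
  proof (rule ex_ex1I [OF induced_hom_exists])
    fix h h' assume *: "?P h" "?P h'"
    show "h = h'"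
    proof (rule extensionalityI [of _ "carrier L"])
      fix x assume "x \<in> carrier L"
      then show "h x = h' x"
        using * by (metis every_element_at_a_stage)
    qed (use * in auto)
  qed
  from theI' [OF this, folded canonical_hom_def]
  show ?hom and "i \<in> I \<Longrightarrow> a \<in> carrier (A i) \<Longrightarrow> canonical_hom I leq A f B g (stage i a) = g i a"
    by auto
qed

text \<open>
  Each element of the limit is represented at one stage \<open>i\<close>.  If its image is trivial, then the
  representative becomes trivial at a later stage \<open>j\<close>, and with it the element of the limit.
\<close>

lemma canonical_hom_iso:
  assumes onto: "\<And>b. b \<in> carrier B \<Longrightarrow> \<exists>i\<in>I. \<exists>a\<in>carrier (A i). b = g i a"
    and dies: "\<And>i a. i \<in> I \<Longrightarrow> a \<in> carrier (A i) \<Longrightarrow> g i a = \<one>\<^bsub>B\<^esub> \<Longrightarrow>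
                 \<exists>j\<in>I. leq i j \<and> f i j a = \<one>\<^bsub>A j\<^esub>"
  shows "canonical_hom I leq A f B g \<in> iso L B"
proof -
  let ?h = "canonical_hom I leq A f B g"
  interpret h: group_hom L B ?h
    using group_L comm_group_B canonical_hom_spec(1)
    by (simp add: group_hom_def group_hom_axioms_def comm_group_def)
  have "x = \<one>\<^bsub>L\<^esub>" if x: "x \<in> carrier L" "?h x = \<one>\<^bsub>B\<^esub>" for x
  proof -
    obtain i a where ia: "i \<in> I" "a \<in> carrier (A i)" "x = stage i a"
      using every_element_at_a_stage x(1) by metis
    then obtain j where j: "j \<in> I" "leq i j" "f i j a = \<one>\<^bsub>A j\<^esub>"
      using dies x(2) canonical_hom_spec(2) by metis
    have "x = stage j \<one>\<^bsub>A j\<^esub>"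
      using stage_transition [OF ia(1) j(1,2) ia(2)] ia(3) j(3) by simp
    also have "\<dots> = \<one>\<^bsub>L\<^esub>"
      using hom_one [OF stage_hom group_A group_L] j(1) by simp
    finally show ?thesis .
  qed
  moreover have "carrier B \<subseteq> ?h ` carrier L"
  proof
    fix b assume "b \<in> carrier B"
    then obtain i a where "i \<in> I" "a \<in> carrier (A i)" "b = g i a"
      using onto by blast
    then show "b \<in> ?h ` carrier L"
      by (metis canonical_hom_spec(2) imageI stage_closed)
  qed
  ultimately show ?thesis
    unfolding h.iso_iff by (auto simp: image_subset_iff)
qed

end

section \<open>Groups of edges\<close>

lemma bw_edges_iff: "e \<in> bw_edges E \<Omega> \<longleftrightarrow> e \<in> arcs E \<and> (tail E e \<in> \<Omega> \<or> head E e \<in> \<Omega>)"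
  by (auto simp: bw_edges_def black_def white_def)

lemma bw_edges_mono: "\<Omega> \<subseteq> \<Omega>' \<Longrightarrow> bw_edges E \<Omega> \<subseteq> bw_edges E \<Omega>'"
  by (auto simp: bw_edges_iff)

lemma black_mono: "\<Omega> \<subseteq> \<Omega>' \<Longrightarrow> black E \<Omega> \<subseteq> black E \<Omega>'"
  by (auto simp: black_def)

text \<open>
  The edges that continue a black edge \<open>x\<close> start in \<open>head E x \<in> \<Omega>\<close>, so all of them already
  belong to \<open>\<Omega>\<close>; a larger vertex set adds no term to the relation of \<open>x\<close>.
\<close>

lemma edge_relation_mono:
  assumes "x \<in> black E \<Omega>" "\<Omega> \<subseteq> \<Omega>'"
  shows "edge_relation E rv \<Omega>' x = edge_relation E rv \<Omega> x"
proof -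
  have "{y \<in> bw_edges E \<Omega>'. lam E rv x y \<noteq> 0} = {y \<in> bw_edges E \<Omega>. lam E rv x y \<noteq> 0}"
    using assms by (auto simp: bw_edges_iff black_def lam_def split: if_splits)
  then show ?thesis by (simp add: edge_relation_def)
qed

lemma edge_relation_closed:
  assumes "x \<in> black E \<Omega>"
  shows "edge_relation E rv \<Omega> x \<in> carrier (free_Abelian_group (bw_edges E \<Omega>))"
proof -
  let ?Y = "{y \<in> bw_edges E \<Omega>. lam E rv x y \<noteq> 0}"
  have "(\<Sum>y\<in>?Y. frag_cmul (lam E rv x y) (frag_of y))
      \<in> carrier (free_Abelian_group (bw_edges E \<Omega>))"
    by (rule sum_closed_free_Abelian_group) (auto simp: lam_def)
  moreover have "x \<in> bw_edges E \<Omega>" using assms by (simp add: bw_edges_def)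
  ultimately show ?thesis
    unfolding edge_relation_def using keys_diff [of "frag_of x"] by fastforce
qed

lemma subgroup_edge_relations:
  "subgroup (edge_relations E rv \<Omega>) (free_Abelian_group (bw_edges E \<Omega>))"
  unfolding edge_relations_def
  by (rule group.generate_is_subgroup) (auto simp: edge_relation_closed simp del: carrier_free_Abelian_group_iff)

lemma normal_edge_relations:
  "edge_relations E rv \<Omega> \<lhd> free_Abelian_group (bw_edges E \<Omega>)"
  by (simp add: comm_group.normal_iff_subgroup abelian_free_Abelian_group subgroup_edge_relations)

lemma comm_group_F_obj: "comm_group (F_obj E rv \<Omega>)"
  unfolding F_obj_def
  by (rule comm_group.abelian_FactGroup [OF abelian_free_Abelian_group subgroup_edge_relations])

lemma group_F_obj: "group (F_obj E rv \<Omega>)"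
  using comm_group_F_obj unfolding comm_group_def by blast

text \<open>
  The whole quotient map, of which \<open>F_gen\<close> is the restriction to generators.  It gives a name
  to every element of \<open>F_obj E rv \<Omega>\<close>.
\<close>

definition F_class ::
  "('v, 'e) pre_digraph \<Rightarrow> ('e \<Rightarrow> 'e) \<Rightarrow> 'v set \<Rightarrow> ('e \<Rightarrow>\<^sub>0 int) \<Rightarrow> ('e \<Rightarrow>\<^sub>0 int) set" where
  "F_class E rv \<Omega> a = edge_relations E rv \<Omega> #>\<^bsub>free_Abelian_group (bw_edges E \<Omega>)\<^esub> a"

lemma F_gen_eq_F_class: "F_gen E rv \<Omega> e = F_class E rv \<Omega> (frag_of e)"
  by (simp add: F_gen_def F_class_def)

lemma F_class_hom: "F_class E rv \<Omega> \<in> hom (free_Abelian_group (bw_edges E \<Omega>)) (F_obj E rv \<Omega>)"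
  using normal.r_coset_hom_Mod [OF normal_edge_relations]
  by (simp add: F_class_def [abs_def] F_obj_def)

lemma carrier_F_obj:
  "carrier (F_obj E rv \<Omega>) = F_class E rv \<Omega> ` {a. Poly_Mapping.keys a \<subseteq> bw_edges E \<Omega>}"
  by (auto simp: F_obj_def carrier_FactGroup F_class_def)

lemma F_class_eq_one_iff:
  assumes "Poly_Mapping.keys a \<subseteq> bw_edges E \<Omega>"
  shows "F_class E rv \<Omega> a = \<one>\<^bsub>F_obj E rv \<Omega>\<^esub> \<longleftrightarrow> a \<in> edge_relations E rv \<Omega>"
proof -
  interpret group "free_Abelian_group (bw_edges E \<Omega>)" by simp
  show ?thesis
    using assms coset_join1 [OF _ _ subgroup_edge_relations]
      coset_join2 [OF _ subgroup_edge_relations]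
    by (auto simp: F_class_def F_obj_def)
qed

lemma keys_edge_relations:
  "a \<in> edge_relations E rv \<Omega> \<Longrightarrow> Poly_Mapping.keys a \<subseteq> bw_edges E \<Omega>"
  using subgroup.subset [OF subgroup_edge_relations] by fastforce

lemma zero_edge_relations: "0 \<in> edge_relations E rv \<Omega>"
  using subgroup.one_closed [OF subgroup_edge_relations] by simp

lemma uminus_edge_relations:
  assumes "a \<in> edge_relations E rv \<Omega>"
  shows "- a \<in> edge_relations E rv \<Omega>"
  using subgroup.m_inv_closed [OF subgroup_edge_relations assms] keys_edge_relations [OF assms]
  by simp

lemma add_edge_relations:
  assumes "a \<in> edge_relations E rv \<Omega>" "b \<in> edge_relations E rv \<Omega>"
  shows "a + b \<in> edge_relations E rv \<Omega>"
  using subgroup.m_closed [OF subgroup_edge_relations assms] by simp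

text \<open>
  The free group on the edges is written additively, and its operations do not depend on the set
  of edges.  This makes it possible to follow one relation through groups over different vertex
  sets.
\<close>

lemma edge_relations_induct [consumes 1, case_names zero rel uminus add]:
  assumes "a \<in> edge_relations E rv \<Omega>"
    and zero: "P 0"
    and rel: "\<And>x. x \<in> black E \<Omega> \<Longrightarrow> P (edge_relation E rv \<Omega> x)"
    and uminus: "\<And>a. P a \<Longrightarrow> P (- a)"
    and add: "\<And>a b. P a \<Longrightarrow> P b \<Longrightarrow> P (a + b)"
  shows "P a"
  using assms(1) unfolding edge_relations_def
proof (induction a rule: generate.induct)
  case (inv h)
  then obtain x where "x \<in> black E \<Omega>" "h = edge_relation E rv \<Omega> x" by blast
  then show ?case
    using uminus [OF rel] edge_relation_closed by fastforce
qed (auto intro: zero rel add)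

lemma edge_relations_mono:
  assumes "\<Omega> \<subseteq> \<Omega>'" "a \<in> edge_relations E rv \<Omega>"
  shows "a \<in> edge_relations E rv \<Omega>'"
  using assms(2)
proof (induction a rule: edge_relations_induct)
  case (rel x)
  then have "edge_relation E rv \<Omega> x \<in> edge_relation E rv \<Omega>' ` black E \<Omega>'"
    using black_mono [OF assms(1), of E] edge_relation_mono [OF rel assms(1), of rv]
    by (metis imageI subsetD)
  then show ?case
    unfolding edge_relations_def by (rule generate.incl)
qed (auto intro: zero_edge_relations uminus_edge_relations add_edge_relations)

text \<open>
  By \<open>edge_relations_mono\<close>, the quotient map for \<open>\<Omega>'\<close> kills the relations for \<open>\<Omega>\<close>, so it factors through
  \<open>F_obj E rv \<Omega>\<close>.
\<close>

lemma F_mor_exists: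
  assumes "\<Omega> \<subseteq> \<Omega>'"
  shows "\<exists>h. h \<in> hom (F_obj E rv \<Omega>) (F_obj E rv \<Omega>') \<and> h \<in> extensional (carrier (F_obj E rv \<Omega>)) \<and>
     (\<forall>a. Poly_Mapping.keys a \<subseteq> bw_edges E \<Omega> \<longrightarrow> h (F_class E rv \<Omega> a) = F_class E rv \<Omega>' a)"
proof -
  let ?A = "free_Abelian_group (bw_edges E \<Omega>)"
  have sub: "x \<in> carrier (free_Abelian_group (bw_edges E \<Omega>'))" if "x \<in> carrier ?A" for x
    using that bw_edges_mono [OF assms, of E] by simp
  have hom: "F_class E rv \<Omega>' \<in> hom ?A (F_obj E rv \<Omega>')"
  proof (rule homI)
    show "F_class E rv \<Omega>' x \<in> carrier (F_obj E rv \<Omega>')" if "x \<in> carrier ?A" for x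
      by (rule hom_in_carrier [OF F_class_hom sub [OF that]])
    show "F_class E rv \<Omega>' (x \<otimes>\<^bsub>?A\<^esub> y) = F_class E rv \<Omega>' x \<otimes>\<^bsub>F_obj E rv \<Omega>'\<^esub> F_class E rv \<Omega>' y"
      if "x \<in> carrier ?A" "y \<in> carrier ?A" for x y
      using hom_mult [OF F_class_hom sub [OF that(1)] sub [OF that(2)]]
      by (simp only: mult_free_Abelian_group)
  qed
  interpret group_hom ?A "F_obj E rv \<Omega>'" "F_class E rv \<Omega>'"
    using hom by (simp add: group_hom_def group_hom_axioms_def group_F_obj)
  have "edge_relations E rv \<Omega> \<subseteq> kernel ?A (F_obj E rv \<Omega>') (F_class E rv \<Omega>')"
  proof
    fix a assume a: "a \<in> edge_relations E rv \<Omega>"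
    have keys: "Poly_Mapping.keys a \<subseteq> bw_edges E \<Omega>"
      by (rule keys_edge_relations [OF a])
    then have "F_class E rv \<Omega>' a = \<one>\<^bsub>F_obj E rv \<Omega>'\<^esub>"
      using F_class_eq_one_iff [of a E \<Omega>' rv] edge_relations_mono [OF assms a]
        bw_edges_mono [OF assms, of E] by blast
    then show "a \<in> kernel ?A (F_obj E rv \<Omega>') (F_class E rv \<Omega>')"
      using keys by (simp add: kernel_def)
  qed
  from FactGroup_universal_kernel [OF normal_edge_relations this]
  obtain h where h: "h \<in> hom (F_obj E rv \<Omega>) (F_obj E rv \<Omega>')"
    "\<And>a. a \<in> carrier ?A \<Longrightarrow> h (F_class E rv \<Omega> a) = F_class E rv \<Omega>' a"
    unfolding F_obj_def [of E rv \<Omega>] F_class_def [of E rv \<Omega>] by blast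
  interpret F: group "F_obj E rv \<Omega>" by (rule group_F_obj)
  show ?thesis
  proof (intro exI conjI allI impI)
    show "restrict h (carrier (F_obj E rv \<Omega>)) \<in> hom (F_obj E rv \<Omega>) (F_obj E rv \<Omega>')"
      using h(1) by (simp add: hom_def Pi_iff)
    show "restrict h (carrier (F_obj E rv \<Omega>)) (F_class E rv \<Omega> a) = F_class E rv \<Omega>' a"
      if "Poly_Mapping.keys a \<subseteq> bw_edges E \<Omega>" for a
      using that h(2) [of a] hom_in_carrier [OF F_class_hom, of a E \<Omega> rv] by simp
  qed simp
qed

text \<open>
  The edges generate the free group, so a homomorphism is determined by the classes of edges, and
  the description by which \<open>F_mor\<close> is defined picks out the homomorphism just constructed.
\<close>

lemma F_mor_spec:
  assumes "\<Omega> \<subseteq> \<Omega>'"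
  shows F_mor_hom: "F_mor E rv (\<Omega>, \<Omega>') \<in> hom (F_obj E rv \<Omega>) (F_obj E rv \<Omega>')" (is ?hom)
    and F_mor_F_class: "Poly_Mapping.keys a \<subseteq> bw_edges E \<Omega> \<Longrightarrow>
           F_mor E rv (\<Omega>, \<Omega>') (F_class E rv \<Omega> a) = F_class E rv \<Omega>' a" (is "_ \<Longrightarrow> ?class")
proof -
  let ?A = "free_Abelian_group (bw_edges E \<Omega>)"
  let ?P = "\<lambda>h. h \<in> hom (F_obj E rv \<Omega>) (F_obj E rv \<Omega>') \<and>
                h \<in> extensional (carrier (F_obj E rv \<Omega>)) \<and>
                (\<forall>e\<in>bw_edges E \<Omega>. h (F_gen E rv \<Omega> e) = F_gen E rv \<Omega>' e)"
  have unique: "h = h'" if P: "?P h" "?P h'" for h h'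
  proof (rule extensionalityI [of _ "carrier (F_obj E rv \<Omega>)"])
    have hom: "group_hom ?A (F_obj E rv \<Omega>') (k \<circ> F_class E rv \<Omega>)" if "?P k" for k
      using that hom_compose [OF F_class_hom, of k E rv \<Omega> "F_obj E rv \<Omega>'"]
      by (simp add: group_hom_def group_hom_axioms_def group_F_obj)
    interpret h: group_hom ?A "F_obj E rv \<Omega>'" "h \<circ> F_class E rv \<Omega>" by (rule hom [OF P(1)])
    interpret h': group_hom ?A "F_obj E rv \<Omega>'" "h' \<circ> F_class E rv \<Omega>" by (rule hom [OF P(2)])
    fix x assume "x \<in> carrier (F_obj E rv \<Omega>)"
    then obtain b where b: "Poly_Mapping.keys b \<subseteq> bw_edges E \<Omega>" "x = F_class E rv \<Omega> b"
      by (auto simp: carrier_F_obj)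
    have "(h \<circ> F_class E rv \<Omega>) b = (h' \<circ> F_class E rv \<Omega>) b"
    proof (rule free_Abelian_group_induct [OF b(1)])
      show "(h \<circ> F_class E rv \<Omega>) 0 = (h' \<circ> F_class E rv \<Omega>) 0"
        using h.hom_one h'.hom_one by (simp only: one_free_Abelian_group)
      show "(h \<circ> F_class E rv \<Omega>) (frag_of e) = (h' \<circ> F_class E rv \<Omega>) (frag_of e)"
        if "e \<in> bw_edges E \<Omega>" for e
        using P that by (simp add: F_gen_eq_F_class)
      fix y z :: "'b \<Rightarrow>\<^sub>0 int"
      assume y: "Poly_Mapping.keys y \<subseteq> bw_edges E \<Omega>" and z: "Poly_Mapping.keys z \<subseteq> bw_edges E \<Omega>"
        and eq: "(h \<circ> F_class E rv \<Omega>) y = (h' \<circ> F_class E rv \<Omega>) y"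
          "(h \<circ> F_class E rv \<Omega>) z = (h' \<circ> F_class E rv \<Omega>) z"
      have *: "y - z = y \<otimes>\<^bsub>?A\<^esub> inv\<^bsub>?A\<^esub> z" using z by simp
      have iz: "inv\<^bsub>?A\<^esub> z \<in> carrier ?A" using z by simp
      have yz: "y \<in> carrier ?A" "z \<in> carrier ?A" using y z by simp_all
      show "(h \<circ> F_class E rv \<Omega>) (y - z) = (h' \<circ> F_class E rv \<Omega>) (y - z)"
        unfolding * h.hom_mult [OF yz(1) iz] h.hom_inv [OF yz(2)]
          h'.hom_mult [OF yz(1) iz] h'.hom_inv [OF yz(2)] eq ..
    qed
    then show "h x = h' x" using b(2) by simp
  qed (use P in auto)
  obtain k where k: "k \<in> hom (F_obj E rv \<Omega>) (F_obj E rv \<Omega>')"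
    "k \<in> extensional (carrier (F_obj E rv \<Omega>))"
    "\<And>a. Poly_Mapping.keys a \<subseteq> bw_edges E \<Omega> \<Longrightarrow> k (F_class E rv \<Omega> a) = F_class E rv \<Omega>' a"
    using F_mor_exists [OF assms] by metis
  then have Pk: "?P k" by (simp add: F_gen_eq_F_class)
  have mor: "F_mor E rv (\<Omega>, \<Omega>') = k"
    unfolding F_mor_def prod.case by (rule the_equality [where P = ?P, OF Pk]) (rule unique [OF _ Pk])
  show ?hom unfolding mor by (rule k(1))
  show ?class if "Poly_Mapping.keys a \<subseteq> bw_edges E \<Omega>" unfolding mor by (rule k(3) [OF that])
qed


section \<open>Direct limits of black-and-white subgraphs\<close>

text \<open>
  Black edges are in particular edges, so absorbing all edges of the smaller subgraph as black
  edges survives composition.  The only other chains are trivial.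
\<close>

lemma elementary_chain:
  assumes "(elementary E)\<^sup>+\<^sup>+ \<Omega> \<Omega>'"
  shows "\<Omega> = \<Omega>' \<or> \<Omega> \<subseteq> \<Omega>' \<and> bw_edges E \<Omega> \<subseteq> black E \<Omega>'"
  using assms
proof (induction rule: tranclp_induct)
  case (base \<Omega>')
  then show ?case by (auto simp: elementary_def)
next
  case (step \<Omega>' \<Omega>'')
  then have "\<Omega>' = \<Omega>'' \<or> \<Omega>' \<subseteq> \<Omega>'' \<and> bw_edges E \<Omega>' \<subseteq> black E \<Omega>''"
    by (auto simp: elementary_def)
  moreover have "black E \<Omega>' \<subseteq> bw_edges E \<Omega>'" by (auto simp: bw_edges_def)
  ultimately show ?case using step.IH by blast
qed

lemma elementary_chain_subset: "(elementary E)\<^sup>+\<^sup>+ \<Omega> \<Omega>' \<Longrightarrow> \<Omega> \<subseteq> \<Omega>'"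
  using elementary_chain by blast

lemma direct_system_bwD:
  assumes "direct_system (bw_category E) I leq X \<phi>"
  shows "directed_set I leq"
    and "i \<in> I \<Longrightarrow> X i \<subseteq> verts E"
    and "i \<in> I \<Longrightarrow> j \<in> I \<Longrightarrow> leq i j \<Longrightarrow> \<phi> i j = (X i, X j)"
    and "i \<in> I \<Longrightarrow> j \<in> I \<Longrightarrow> leq i j \<Longrightarrow> (elementary E)\<^sup>+\<^sup>+ (X i) (X j)"
  using assms by (auto simp: direct_system_def bw_category_def)

text \<open>
  Either the system becomes stationary, and the union is one of its members, or every member is
  eventually enlarged.  In the second case all edges that touch the union are black in it.  Then
  the union has no white edges, the condition on white edges is vacuous, and each inclusion into
  the union is a single elementary homomorphism.
\<close>

lemma union_receives_chains:
  assumes sys: "direct_system (bw_category E) I leq X \<phi>" and i: "i \<in> I"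
  shows "(elementary E)\<^sup>+\<^sup>+ (X i) (\<Union>j\<in>I. X j)"
proof (cases "\<exists>m\<in>I. \<forall>j\<in>I. leq m j \<longrightarrow> X j = X m")
  case True
  then obtain m where m: "m \<in> I" "\<And>j. j \<in> I \<Longrightarrow> leq m j \<Longrightarrow> X j = X m" by blast
  have to_m: "(elementary E)\<^sup>+\<^sup>+ (X k) (X m)" if k: "k \<in> I" for k
  proof -
    obtain l where "l \<in> I" "leq k l" "leq m l"
      using directed_set_upper_bound [OF direct_system_bwD(1) [OF sys] k m(1)] .
    then show ?thesis using direct_system_bwD(4) [OF sys k] m(2) by metis
  qed
  then have "(\<Union>j\<in>I. X j) = X m"
    using m(1) elementary_chain_subset by blast
  then show ?thesis using to_m [OF i] by simp
next
  case False
  have absorbed: "bw_edges E (X k) \<subseteq> black E (\<Union>j\<in>I. X j)" if k: "k \<in> I" for k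
  proof -
    obtain j where j: "j \<in> I" "leq k j" "X j \<noteq> X k" using False k by blast
    then have "bw_edges E (X k) \<subseteq> black E (X j)"
      using elementary_chain [OF direct_system_bwD(4) [OF sys k j(1,2)]] by auto
    also have "\<dots> \<subseteq> black E (\<Union>j\<in>I. X j)" using j by (intro black_mono) blast
    finally show ?thesis .
  qed
  have "white E (\<Union>j\<in>I. X j) = {}"
  proof (rule ccontr)
    assume "white E (\<Union>j\<in>I. X j) \<noteq> {}"
    then obtain e where e: "e \<in> white E (\<Union>j\<in>I. X j)" by blast
    then obtain k where "k \<in> I" "e \<in> bw_edges E (X k)"
      by (auto simp: white_def bw_edges_iff)
    then show False using absorbed e by (auto simp: white_def black_def)
  qed
  then have "elementary E (X i) (\<Union>j\<in>I. X j)"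
    using absorbed [OF i] i direct_system_bwD(2) [OF sys] by (auto simp: elementary_def)
  then show ?thesis by blast
qed

text \<open>
  The union with its inclusions is a cocone.  Since morphisms are inclusions, the morphism from the
  limit to this cocone bounds the limit by the union.
\<close>

lemma direct_limit_eq_union:
  assumes sys: "direct_system (bw_category E) I leq X \<phi>"
    and lim: "is_direct_limit (bw_category E) I leq X \<phi> G \<psi>"
  shows "G = (\<Union>i\<in>I. X i)" and "i \<in> I \<Longrightarrow> \<psi> i = (X i, G)"
proof -
  have \<psi>: "\<psi> i = (X i, G) \<and> (elementary E)\<^sup>+\<^sup>+ (X i) G" if "i \<in> I" for i
    using lim that by (auto simp: is_direct_limit_def cocone_def bw_category_def)
  then show "i \<in> I \<Longrightarrow> \<psi> i = (X i, G)" by blast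
  have "cocone (bw_category E) I leq X \<phi> (\<Union>i\<in>I. X i) (\<lambda>i. (X i, \<Union>i\<in>I. X i))"
    using union_receives_chains [OF sys] direct_system_bwD(2,3) [OF sys]
    by (auto simp: cocone_def bw_category_def)
  then obtain u where "u \<in> Hom (bw_category E) G (\<Union>i\<in>I. X i)"
    using lim unfolding is_direct_limit_def by blast
  then have "G \<subseteq> (\<Union>i\<in>I. X i)"
    using elementary_chain_subset [of E G] by (simp add: bw_category_def)
  then show "G = (\<Union>i\<in>I. X i)"
    using \<psi> elementary_chain_subset by blast
qed


section \<open>Continuity of the functor\<close>

lemma directed_finite_subset:
  assumes dir: "directed_set I leq"
    and mono: "\<And>i j. i \<in> I \<Longrightarrow> j \<in> I \<Longrightarrow> leq i j \<Longrightarrow> M i \<subseteq> M j"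
    and "finite T" "T \<subseteq> (\<Union>i\<in>I. M i)"
  shows "\<exists>i\<in>I. T \<subseteq> M i"
  using assms(3,4)
proof (induction T rule: finite_induct)
  case empty
  then show ?case using directed_set_nonempty [OF dir] by blast
next
  case (insert x T)
  then obtain i j where ij: "i \<in> I" "T \<subseteq> M i" "j \<in> I" "x \<in> M j" by auto
  then obtain k where "k \<in> I" "leq i k" "leq j k"
    using directed_set_upper_bound [OF dir] by metis
  then have "insert x T \<subseteq> M k"
    using ij mono [of i k] mono [of j k] by blast
  then show ?case using \<open>k \<in> I\<close> by blast
qed

text \<open>
  A black edge of the union has both endpoints in a common member, so it is black there, with the
  same relation.  A consequence of finitely many such relations is therefore valid at a common
  member as well.
\<close>

lemma edge_relations_union:
  assumes dir: "directed_set I leq"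
    and mono: "\<And>i j. i \<in> I \<Longrightarrow> j \<in> I \<Longrightarrow> leq i j \<Longrightarrow> X i \<subseteq> X j"
    and "a \<in> edge_relations E rv (\<Union>i\<in>I. X i)"
  shows "\<exists>i\<in>I. a \<in> edge_relations E rv (X i)"
proof -
  let ?U = "\<Union>i\<in>I. X i"
  have at_stage: "\<exists>i\<in>I. edge_relation E rv ?U x \<in> edge_relations E rv (X i)" if x: "x \<in> black E ?U" for x
  proof -
    have "\<exists>i\<in>I. {tail E x, head E x} \<subseteq> X i"
      by (rule directed_finite_subset [OF dir mono]) (use x in \<open>auto simp: black_def\<close>)
    then obtain i where i: "i \<in> I" "x \<in> black E (X i)"
      using x by (auto simp: black_def)
    then have "edge_relation E rv ?U x = edge_relation E rv (X i) x"
      by (intro edge_relation_mono) auto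
    then show ?thesis
      using i unfolding edge_relations_def by (auto intro: generate.incl)
  qed
  show ?thesis
    using assms(3)
  proof (induction a rule: edge_relations_induct)
    case zero
    obtain i where "i \<in> I" using directed_set_nonempty [OF dir] .
    then show ?case using zero_edge_relations by blast
  next
    case (rel x)
    then show ?case by (rule at_stage)
  next
    case (uminus a)
    then show ?case using uminus_edge_relations by blast
  next
    case (add a b)
    then obtain i j where ij: "i \<in> I" "a \<in> edge_relations E rv (X i)"
      "j \<in> I" "b \<in> edge_relations E rv (X j)" by blast
    then obtain k where k: "k \<in> I" "leq i k" "leq j k"
      using directed_set_upper_bound [OF dir] by metis
    have "a \<in> edge_relations E rv (X k)" "b \<in> edge_relations E rv (X k)"
      by (rule edge_relations_mono [OF mono [OF ij(1) k(1,2)] ij(2)],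
          rule edge_relations_mono [OF mono [OF ij(3) k(1,3)] ij(4)])
    then show ?case using k(1) add_edge_relations by blast
  qed
qed

theorem theorem2p2:
  fixes E :: "('v, 'e) pre_digraph"
    and rv :: "'e \<Rightarrow> 'e"
    and I :: "'i set"
    and leq :: "'i \<Rightarrow> 'i \<Rightarrow> bool"
    and X :: "'i \<Rightarrow> 'v set"
    and \<phi> :: "'i \<Rightarrow> 'i \<Rightarrow> 'v set \<times> 'v set"
    and G :: "'v set"
    and \<psi> :: "'i \<Rightarrow> 'v set \<times> 'v set"
  assumes "bidirected_digraph E rv"
    and "infinite (verts E)"
    and "locally_finite E"
    and "Digraph_Component.connected E"
    and "direct_system (bw_category E) I leq X \<phi>"
    and "is_direct_limit (bw_category E) I leq X \<phi> G \<psi>"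
  shows "canonical_hom I leq (\<lambda>i. F_obj E rv (X i)) (\<lambda>i j. F_mor E rv (\<phi> i j))
           (F_obj E rv G) (\<lambda>i. F_mor E rv (\<psi> i))
         \<in> iso (limit_group I leq (\<lambda>i. F_obj E rv (X i)) (\<lambda>i j. F_mor E rv (\<phi> i j)))
               (F_obj E rv G)"
proof -
  note sys = direct_system_bwD [OF assms(5)] and lim = direct_limit_eq_union [OF assms(5,6)]
  have mono: "X i \<subseteq> X j" if "i \<in> I" "j \<in> I" "leq i j" for i j
    using elementary_chain_subset [OF sys(4) [OF that]] .
  have sub: "X i \<subseteq> G" if "i \<in> I" for i using lim(1) that by blast
  have keys_mono: "Poly_Mapping.keys a \<subseteq> bw_edges E \<Omega>'"
    if "Poly_Mapping.keys a \<subseteq> bw_edges E \<Omega>" "\<Omega> \<subseteq> \<Omega>'" for a :: "'e \<Rightarrow>\<^sub>0 int" and \<Omega> \<Omega>'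
    using that(1) bw_edges_mono [OF that(2)] by (rule subset_trans)
  interpret compatible_family I leq "\<lambda>i. F_obj E rv (X i)" "\<lambda>i j. F_mor E rv (\<phi> i j)"
    "F_obj E rv G" "\<lambda>i. F_mor E rv (\<psi> i)"
  proof (rule compatible_family.intro)
    show "F_mor E rv (\<phi> i j) \<in> hom (F_obj E rv (X i)) (F_obj E rv (X j))"
      if "i \<in> I" "j \<in> I" "leq i j" for i j
      using that mono by (simp add: sys(3) F_mor_hom)
    show "F_mor E rv (\<psi> i) \<in> hom (F_obj E rv (X i)) (F_obj E rv G)" if "i \<in> I" for i
      using that sub by (simp add: lim(2) F_mor_hom)
    fix i j a assume ij: "i \<in> I" "j \<in> I" "leq i j" and "a \<in> carrier (F_obj E rv (X i))"
    then obtain b where b: "Poly_Mapping.keys b \<subseteq> bw_edges E (X i)" "a = F_class E rv (X i) b"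
      by (auto simp: carrier_F_obj)
    then show "F_mor E rv (\<psi> j) (F_mor E rv (\<phi> i j) a) = F_mor E rv (\<psi> i) a"
      using ij mono [OF ij] sub keys_mono [OF b(1) mono [OF ij]]
      by (simp add: sys(3) lim(2) F_mor_F_class)
  qed (simp_all add: sys(1) comm_group_F_obj)
  show ?thesis
  proof (rule canonical_hom_iso)
    fix b assume "b \<in> carrier (F_obj E rv G)"
    then obtain a where a: "Poly_Mapping.keys a \<subseteq> bw_edges E G" "b = F_class E rv G a"
      by (auto simp: carrier_F_obj)
    have "\<exists>i\<in>I. Poly_Mapping.keys a \<subseteq> bw_edges E (X i)"
      by (rule directed_finite_subset [OF sys(1) bw_edges_mono [OF mono]])
        (use a(1) lim(1) in \<open>auto simp: bw_edges_iff subset_iff\<close>)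
    then obtain i where i: "i \<in> I" "Poly_Mapping.keys a \<subseteq> bw_edges E (X i)" by blast
    then have "b = F_mor E rv (\<psi> i) (F_class E rv (X i) a)"
      using a(2) sub by (simp add: lim(2) F_mor_F_class)
    then show "\<exists>i\<in>I. \<exists>c\<in>carrier (F_obj E rv (X i)). b = F_mor E rv (\<psi> i) c"
      using i by (auto simp: carrier_F_obj)
  next
    fix i c assume i: "i \<in> I" and "c \<in> carrier (F_obj E rv (X i))"
      and one: "F_mor E rv (\<psi> i) c = \<one>\<^bsub>F_obj E rv G\<^esub>"
    then obtain a where a: "Poly_Mapping.keys a \<subseteq> bw_edges E (X i)" "c = F_class E rv (X i) a"
      by (auto simp: carrier_F_obj)
    have "F_class E rv G a = \<one>\<^bsub>F_obj E rv G\<^esub>"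
      using one a i sub by (simp add: lim(2) F_mor_F_class)
    then have "a \<in> edge_relations E rv G"
      using F_class_eq_one_iff [OF keys_mono [OF a(1) sub [OF i]]] by blast
    then have "a \<in> edge_relations E rv (\<Union>i\<in>I. X i)"
      unfolding lim(1) .
    then have "\<exists>k\<in>I. a \<in> edge_relations E rv (X k)"
      using edge_relations_union [where X = X and a = a and E = E and rv = rv, OF sys(1) mono]
      by simp
    then obtain k where k: "k \<in> I" "a \<in> edge_relations E rv (X k)" by blast
    obtain j where j: "j \<in> I" "leq i j" "leq k j"
      using directed_set_upper_bound [OF sys(1) i k(1)] .
    then have "a \<in> edge_relations E rv (X j)"
      using edge_relations_mono [OF mono [OF k(1) j(1,3)] k(2)] by blast
    then have "F_class E rv (X j) a = \<one>\<^bsub>F_obj E rv (X j)\<^esub>"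
      using F_class_eq_one_iff [OF keys_mono [OF a(1) mono [OF i j(1,2)]]] by blast
    then have "F_mor E rv (\<phi> i j) c = \<one>\<^bsub>F_obj E rv (X j)\<^esub>"
      using a i j mono [OF i j(1,2)] by (simp add: sys(3) F_mor_F_class)
    then show "\<exists>j\<in>I. leq i j \<and> F_mor E rv (\<phi> i j) c = \<one>\<^bsub>F_obj E rv (X j)\<^esub>"
      using j by blast
  qed
qed

end
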